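(* Let $E=(E_{n,k})_{n,k\geq1}$ be an infinite matrix which defines a matrix mapping on $\ell^2(\mathbb{N})$. Then $E$ induces a bounded operator on $\ell^2(\mathbb{N})$; that is, the map $c=\{c_k\}_{k=1}^\infty\mapsto Ec=\{\sum_{k=1}^\infty E_{n,k}c_k\}_{n=1}^\infty$ is a bounded linear operator from $\ell^2(\mathbb{N})$ to itself.
   Context: Matrices have real or complex entries, and $\ell^2(\mathbb{N})$ is the space of square-summable scalar sequences. $E$ defines a matrix mapping on $\ell^2(\mathbb{N})$ if for every $c\in\ell^2(\mathbb{N})$ the series $(Ec)_n=\sum_{k=1}^\infty E_{n,k}c_k$ converges for every $n\in\mathbb{N}$ and $Ec=\{(Ec)_n\}_{n=1}^\infty\in\ell^2(\mathbb{N})$. *)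

theory Defs
  imports "HOL-Analysis.Analysis"
begin

definition square_summable :: "(nat \<Rightarrow> 'a::real_normed_vector) \<Rightarrow> bool" where
  "square_summable c \<longleftrightarrow> summable (\<lambda>k. (norm (c k))\<^sup>2)"

lemma square_summable_boundI:
  assumes "\<And>n. L2_set (\<lambda>k. norm (c k)) {..<n} \<le> B"
  shows "square_summable c" and "sqrt (\<Sum>k. (norm (c k))\<^sup>2) \<le> B"
proof -
  have B: "0 \<le> B" using assms[of 0] by simp
  have le: "(\<Sum>k<n. (norm (c k))\<^sup>2) \<le> B\<^sup>2" for n
    using power_mono[OF assms[of n], of 2] by (simp add: L2_set_def sum_nonneg)
  show s: "square_summable c"
    unfolding square_summable_def by (rule summableI_nonneg_bounded[OF _ le]) simp
  have "(\<Sum>k. (norm (c k))\<^sup>2) \<le> B\<^sup>2"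
    using s unfolding square_summable_def by (rule suminf_le_const) (rule le)
  then show "sqrt (\<Sum>k. (norm (c k))\<^sup>2) \<le> B"
    using B by (rule real_le_lsqrt[rotated])
qed

lemma L2_set_le_suminf:
  assumes "square_summable c"
  shows "L2_set (\<lambda>k. norm (c k)) {..<n} \<le> sqrt (\<Sum>k. (norm (c k))\<^sup>2)"
  using assms unfolding L2_set_def square_summable_def
  by (intro real_sqrt_le_mono sum_le_suminf) auto

lemma L2_set_add_le_suminf:
  assumes "square_summable c" "square_summable d"
  shows "L2_set (\<lambda>k. norm (c k + d k)) {..<n}
           \<le> sqrt (\<Sum>k. (norm (c k))\<^sup>2) + sqrt (\<Sum>k. (norm (d k))\<^sup>2)"
proof -
  have "L2_set (\<lambda>k. norm (c k + d k)) {..<n} \<le> L2_set (\<lambda>k. norm (c k) + norm (d k)) {..<n}"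
    by (intro L2_set_mono norm_triangle_ineq norm_ge_zero)
  also have "\<dots> \<le> L2_set (\<lambda>k. norm (c k)) {..<n} + L2_set (\<lambda>k. norm (d k)) {..<n}"
    by (rule L2_set_triangle_ineq)
  finally show ?thesis
    using L2_set_le_suminf[OF assms(1), of n] L2_set_le_suminf[OF assms(2), of n] by linarith
qed

lemma square_summable_zero: "square_summable (\<lambda>_. 0)"
  by (simp add: square_summable_def)

lemma square_summable_add:
  "square_summable c \<Longrightarrow> square_summable d \<Longrightarrow> square_summable (\<lambda>k. c k + d k)"
  by (rule square_summable_boundI(1)[OF L2_set_add_le_suminf])

lemma square_summable_uminus: "square_summable c \<Longrightarrow> square_summable (\<lambda>k. - c k)"
  by (simp add: square_summable_def)

lemma square_summable_scaleR: "square_summable c \<Longrightarrow> square_summable (\<lambda>k. r *\<^sub>R c k)"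
  by (simp add: square_summable_def power_mult_distrib summable_mult)

lemma square_summable_mult:
  fixes c :: "nat \<Rightarrow> 'a::real_normed_field"
  shows "square_summable c \<Longrightarrow> square_summable (\<lambda>k. a * c k)"
  by (simp add: square_summable_def norm_mult power_mult_distrib summable_mult)

typedef (overloaded) 'a ell2 = "{c :: nat \<Rightarrow> 'a::real_normed_vector. square_summable c}"
  morphisms ell2_seq Abs_ell2
  using square_summable_zero by blast

setup_lifting type_definition_ell2

instantiation ell2 :: (real_normed_vector) real_normed_vector
begin

lift_definition zero_ell2 :: "'a ell2" is "\<lambda>_. 0"
  by (rule square_summable_zero)

lift_definition plus_ell2 :: "'a ell2 \<Rightarrow> 'a ell2 \<Rightarrow> 'a ell2" is "\<lambda>c d k. c k + d k"
  by (rule square_summable_add)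

lift_definition uminus_ell2 :: "'a ell2 \<Rightarrow> 'a ell2" is "\<lambda>c k. - c k"
  by (rule square_summable_uminus)

lift_definition minus_ell2 :: "'a ell2 \<Rightarrow> 'a ell2 \<Rightarrow> 'a ell2" is "\<lambda>c d k. c k - d k"
  using square_summable_add square_summable_uminus by fastforce

lift_definition scaleR_ell2 :: "real \<Rightarrow> 'a ell2 \<Rightarrow> 'a ell2" is "\<lambda>r c k. r *\<^sub>R c k"
  by (rule square_summable_scaleR)

lift_definition norm_ell2 :: "'a ell2 \<Rightarrow> real" is "\<lambda>c. sqrt (\<Sum>k. (norm (c k))\<^sup>2)" .

definition dist_ell2 :: "'a ell2 \<Rightarrow> 'a ell2 \<Rightarrow> real" where
  "dist_ell2 c d = norm (c - d)"

definition sgn_ell2 :: "'a ell2 \<Rightarrow> 'a ell2" where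
  "sgn_ell2 c = inverse (norm c) *\<^sub>R c"

definition uniformity_ell2 :: "('a ell2 \<times> 'a ell2) filter" where
  "uniformity_ell2 = (INF e\<in>{0 <..}. principal {(c, d). dist c d < e})"

definition open_ell2 :: "'a ell2 set \<Rightarrow> bool" where
  "open_ell2 U = (\<forall>c\<in>U. eventually (\<lambda>(c', d). c' = c \<longrightarrow> d \<in> U) uniformity)"

instance
proof
  fix x y z :: "'a ell2" and r s :: real and U :: "'a ell2 set"
  show "x + y + z = x + (y + z)" by transfer (simp add: add.assoc)
  show "x + y = y + x" by transfer (simp add: add.commute)
  show "0 + x = x" by transfer simp
  show "- x + x = 0" by transfer simp
  show "x - y = x + - y" by transfer simp
  show "r *\<^sub>R (x + y) = r *\<^sub>R x + r *\<^sub>R y" by transfer (simp add: scaleR_add_right)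
  show "(r + s) *\<^sub>R x = r *\<^sub>R x + s *\<^sub>R x" by transfer (simp add: scaleR_add_left)
  show "r *\<^sub>R s *\<^sub>R x = (r * s) *\<^sub>R x" by transfer simp
  show "1 *\<^sub>R x = x" by transfer simp
  show "dist x y = norm (x - y)" by (rule dist_ell2_def)
  show "sgn x = inverse (norm x) *\<^sub>R x" by (rule sgn_ell2_def)
  show "uniformity = (INF e\<in>{0 <..}. principal {(x, y :: 'a ell2). dist x y < e})"
    by (rule uniformity_ell2_def)
  show "open U = (\<forall>x\<in>U. \<forall>\<^sub>F (x', y) in uniformity. x' = x \<longrightarrow> y \<in> U)"
    by (rule open_ell2_def)
  show "norm x = 0 \<longleftrightarrow> x = 0"
    by transfer (auto simp: square_summable_def suminf_eq_zero_iff fun_eq_iff)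
  show "norm (x + y) \<le> norm x + norm y"
    by transfer (rule square_summable_boundI(2)[OF L2_set_add_le_suminf])
  show "norm (r *\<^sub>R x) = \<bar>r\<bar> * norm x"
    by transfer
      (simp add: square_summable_def power_mult_distrib suminf_mult real_sqrt_mult)
qed

end

text \<open>Multiplication by scalars of the ground field \<open>'a\<close>; for complex scalars
  linearity in this sense is stronger than the real linearity contained in \<^const>\<open>bounded_linear\<close>.\<close>

lift_definition ell2_scale :: "'a::real_normed_field \<Rightarrow> 'a ell2 \<Rightarrow> 'a ell2" is "\<lambda>a c k. a * c k"
  by (rule square_summable_mult)

lemma vector_space_ell2_scale: "vector_space ell2_scale"
  by unfold_locales (transfer; simp add: algebra_simps fun_eq_iff)+

definition matrix_times :: "(nat \<Rightarrow> nat \<Rightarrow> 'a::real_normed_field) \<Rightarrow> (nat \<Rightarrow> 'a) \<Rightarrow> nat \<Rightarrow> 'a" where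
  "matrix_times E c n = (\<Sum>k. E n k * c k)"

definition defines_matrix_mapping :: "(nat \<Rightarrow> nat \<Rightarrow> 'a::real_normed_field) \<Rightarrow> bool" where
  "defines_matrix_mapping E \<longleftrightarrow>
     (\<forall>c. square_summable c \<longrightarrow>
        (\<forall>n. summable (\<lambda>k. E n k * c k)) \<and> square_summable (matrix_times E c))"

end

theory Submission
  imports Defs
begin

text \<open>
  An operator given by an infinite matrix is assembled from finite pieces in two passages to the
  limit: each row functional \<open>c \<mapsto> (E c)\<^sub>n\<close> is the pointwise limit of the finite sums
  \<open>c \<mapsto> (\<Sum>k<m. E\<^sub>n\<^sub>k c\<^sub>k)\<close>, and the norm of \<open>E c\<close> is the supremum over \<open>m\<close> of the Euclidean
  norms of its first \<open>m\<close> coordinates. The finite pieces are bounded for trivial reasons, but with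
  bounds that may grow. What keeps the bounds under control is the uniform boundedness
  principle, used once in each passage. For the rows, convergence of the series makes the finite
  sums pointwise bounded, hence uniformly bounded, so every row functional is bounded. For the
  whole matrix, the first \<open>m\<close> coordinates of \<open>E c\<close> now depend boundedly on \<open>c\<close>, and
  \<open>E c \<in> \<ell>\<^sup>2\<close> makes their Euclidean norms pointwise bounded, hence uniformly bounded; the uniform
  bound is a bound for the operator.

  The principle rests on completeness of \<open>\<ell>\<^sup>2\<close> and Baire's theorem. It is stated for families of
  seminorms, because the norm of a truncation of \<open>E c\<close> is a seminorm in \<open>c\<close>, and no auxiliary
  operators have to be built.
\<close>

section \<open>Completeness of the sequence space\<close>

lemma norm_ell2: "norm c = sqrt (\<Sum>k. (norm (ell2_seq c k))\<^sup>2)"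
  by transfer simp

lemma square_summable_ell2_seq: "square_summable (ell2_seq c)"
  using ell2_seq by blast

lemma L2_set_le_norm_ell2: "L2_set (\<lambda>k. norm (ell2_seq c k)) {..<m} \<le> norm c"
  unfolding norm_ell2 by (rule L2_set_le_suminf[OF square_summable_ell2_seq])

lemma norm_ell2_le:
  assumes "\<And>m. L2_set (\<lambda>k. norm (ell2_seq c k)) {..<m} \<le> B"
  shows "norm c \<le> B"
  unfolding norm_ell2 by (rule square_summable_boundI(2)[OF assms])

lemma norm_ell2_seq_le: "norm (ell2_seq c k) \<le> norm c"
proof -
  have "norm (ell2_seq c k) \<le> L2_set (\<lambda>k. norm (ell2_seq c k)) {..<Suc k}"
    by (rule member_le_L2_set) auto
  also have "\<dots> \<le> norm c"
    by (rule L2_set_le_norm_ell2)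
  finally show ?thesis .
qed

text \<open>
  A Cauchy sequence converges coordinatewise. Each finite section of the Cauchy estimate survives
  this limit, and the bound on all finite sections gives at once that the limit is square summable
  and that the convergence is in norm.
\<close>

instance ell2 :: (banach) banach
proof
  fix X :: "nat \<Rightarrow> 'a ell2"
  assume X: "Cauchy X"
  have "Cauchy (\<lambda>n. ell2_seq (X n) k)" for k
  proof (rule CauchyI)
    fix e :: real assume "0 < e"
    then obtain M where M: "\<And>m n. m \<ge> M \<Longrightarrow> n \<ge> M \<Longrightarrow> norm (X m - X n) < e"
      using X by (meson CauchyD)
    have "norm (ell2_seq (X m) k - ell2_seq (X n) k) \<le> norm (X m - X n)" for m n
      using norm_ell2_seq_le[of "X m - X n" k] by (simp add: minus_ell2.rep_eq)
    with M show "\<exists>M. \<forall>m\<ge>M. \<forall>n\<ge>M. norm (ell2_seq (X m) k - ell2_seq (X n) k) < e"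
      by (meson order.strict_trans1)
  qed
  then obtain l where l: "\<And>k. (\<lambda>n. ell2_seq (X n) k) \<longlonglongrightarrow> l k"
    unfolding Cauchy_convergent_iff convergent_def by metis
  have sections: "\<exists>N. \<forall>m\<ge>N. \<forall>K. L2_set (\<lambda>k. norm (ell2_seq (X m) k - l k)) {..<K} \<le> e"
    if "0 < e" for e
  proof -
    obtain N where N: "\<And>m n. m \<ge> N \<Longrightarrow> n \<ge> N \<Longrightarrow> norm (X m - X n) < e"
      using X \<open>0 < e\<close> by (meson CauchyD)
    have "L2_set (\<lambda>k. norm (ell2_seq (X m) k - l k)) {..<K} \<le> e" if "m \<ge> N" for m K
    proof (rule LIMSEQ_le_const2)
      show "(\<lambda>n. L2_set (\<lambda>k. norm (ell2_seq (X m) k - ell2_seq (X n) k)) {..<K})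
              \<longlonglongrightarrow> L2_set (\<lambda>k. norm (ell2_seq (X m) k - l k)) {..<K}"
        unfolding L2_set_def by (intro tendsto_intros l)
      have "L2_set (\<lambda>k. norm (ell2_seq (X m) k - ell2_seq (X n) k)) {..<K} \<le> e"
        if "n \<ge> N" for n
        using L2_set_le_norm_ell2[of "X m - X n" K] N[OF \<open>m \<ge> N\<close> that]
        by (simp add: minus_ell2.rep_eq)
      then show "\<exists>N. \<forall>n\<ge>N.
          L2_set (\<lambda>k. norm (ell2_seq (X m) k - ell2_seq (X n) k)) {..<K} \<le> e"
        by blast
    qed
    then show ?thesis by blast
  qed
  obtain N where "\<And>K. L2_set (\<lambda>k. norm (ell2_seq (X N) k - l k)) {..<K} \<le> 1"
    using sections[of 1] by auto
  then have "square_summable (\<lambda>k. ell2_seq (X N) k - l k)"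
    by (rule square_summable_boundI(1))
  from square_summable_add[OF square_summable_ell2_seq[of "X N"] square_summable_uminus[OF this]]
  have "square_summable l" by simp
  then have L: "ell2_seq (Abs_ell2 l) = l"
    by (simp add: Abs_ell2_inverse)
  have "X \<longlonglongrightarrow> Abs_ell2 l"
  proof (rule LIMSEQ_I)
    fix e :: real assume "0 < e"
    then obtain N where
      N: "\<And>m K. m \<ge> N \<Longrightarrow> L2_set (\<lambda>k. norm (ell2_seq (X m) k - l k)) {..<K} \<le> e / 2"
      using sections[of "e / 2"] by auto
    have "norm (X m - Abs_ell2 l) < e" if "m \<ge> N" for m
    proof -
      have "norm (X m - Abs_ell2 l) \<le> e / 2"
        using N[OF that] by (intro norm_ell2_le) (simp add: minus_ell2.rep_eq L)
      with \<open>0 < e\<close> show ?thesis by linarith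
    qed
    then show "\<exists>N. \<forall>m\<ge>N. norm (X m - Abs_ell2 l) < e" by blast
  qed
  then show "convergent X" by (auto simp: convergent_def)
qed

section \<open>Uniform boundedness\<close>

text \<open>
  The sets on which all the seminorms are at most \<open>N\<close> are closed and cover the space, so one of
  them contains a ball by Baire's theorem. Subtracting the centre, at the price of a factor \<open>2\<close>,
  moves this ball to the origin, where homogeneity turns it into a bound on the whole space.
\<close>

lemma uniform_boundedness_seminorms:
  fixes p :: "'i \<Rightarrow> 'a::banach \<Rightarrow> real"
  assumes add: "\<And>i x y. p i (x + y) \<le> p i x + p i y"
    and scale: "\<And>i r x. p i (r *\<^sub>R x) = \<bar>r\<bar> * p i x"
    and bounded: "\<And>i. \<exists>K. \<forall>x. p i x \<le> K * norm x"
    and pointwise: "\<And>x. \<exists>B. \<forall>i. p i x \<le> B"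
  shows "\<exists>K. \<forall>i x. p i x \<le> K * norm x"
proof -
  have neg: "p i (- x) = p i x" for i x
    using scale[of i "-1" x] by simp
  have cont: "continuous_on UNIV (p i)" for i
  proof -
    obtain K where K: "\<And>x. p i x \<le> K * norm x" using bounded[of i] by blast
    have le: "p i x - p i y \<le> max 0 K * norm (x - y)" for x y
    proof -
      have "p i x - p i y \<le> p i (x - y)" using add[of i "x - y" y] by simp
      also have "\<dots> \<le> K * norm (x - y)" by (rule K)
      also have "\<dots> \<le> max 0 K * norm (x - y)" by (intro mult_right_mono) auto
      finally show ?thesis .
    qed
    have "(max 0 K)-lipschitz_on UNIV (p i)"
    proof (rule lipschitz_onI)
      fix x y
      show "dist (p i x) (p i y) \<le> max 0 K * dist x y"
        using le[of x y] le[of y x] by (simp add: dist_norm norm_minus_commute abs_le_iff)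
    qed simp
    then show ?thesis by (rule lipschitz_on_continuous_on)
  qed
  define A where "A N = {x. \<forall>i. p i x \<le> real N}" for N :: nat
  have closed: "closed (A N)" for N
  proof -
    have "A N = (\<Inter>i. {x. p i x \<le> real N})" by (auto simp: A_def)
    moreover have "closed {x. p i x \<le> real N}" for i
      by (intro closed_Collect_le cont continuous_on_const)
    ultimately show ?thesis by auto
  qed
  have cover: "(\<Union>N. A N) = UNIV"
  proof -
    have "\<exists>N. x \<in> A N" for x
    proof -
      obtain B where B: "\<And>i. p i x \<le> B" using pointwise by blast
      obtain N :: nat where "B \<le> real N" using real_arch_simple by blast
      with B have "x \<in> A N" unfolding A_def by (auto intro: order_trans)
      then show ?thesis ..
    qed
    then show ?thesis by blast
  qed
  have "\<exists>N. interior (A N) \<noteq> {}"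
  proof (rule ccontr)
    assume "\<nexists>N. interior (A N) \<noteq> {}"
    then have "(euclidean interior_of \<Union>(range A)) = {}"
      by (intro Baire_category_alt disjI1 completely_metrizable_space_euclidean)
        (auto simp: closed)
    then show False using cover by simp
  qed
  then obtain N a r where r: "r > 0" and ball: "ball a r \<subseteq> A N"
    by (metis equals0I mem_interior)
  have small: "p i h \<le> 2 * real N" if "norm h < r" for i h
  proof -
    have "a + h \<in> A N" "a \<in> A N"
      using ball r that by (auto simp: subset_iff dist_norm)
    moreover have "p i h \<le> p i (a + h) + p i a"
      using add[of i "a + h" "- a"] by (simp add: neg)
    ultimately show ?thesis by (auto simp: A_def dest!: spec[of _ i])
  qed
  have "p i x \<le> 4 * real N / r * norm x" for i x
  proof (cases "x = 0")
    case True
    then show ?thesis using scale[of i 0 0] by simp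
  next
    case False
    \<comment> \<open>\<open>x\<close> is rescaled to norm \<open>r / 2\<close>, safely inside the ball.\<close>
    have "r / (2 * norm x) * p i x = p i ((r / (2 * norm x)) *\<^sub>R x)"
      using r by (simp add: scale)
    also have "\<dots> \<le> 2 * real N"
      using False r by (intro small) simp
    finally show ?thesis
      using False r by (simp add: field_simps)
  qed
  then show ?thesis by blast
qed

section \<open>Matrix mappings\<close>

lemma finite_row_bounded:
  fixes a :: "nat \<Rightarrow> 'a::real_normed_field"
  shows "\<exists>K. \<forall>c. norm (\<Sum>k<m. a k * ell2_seq c k) \<le> K * norm c"
proof (intro exI allI)
  fix c :: "'a ell2"
  show "norm (\<Sum>k<m. a k * ell2_seq c k) \<le> (\<Sum>k<m. norm (a k)) * norm c"
    unfolding sum_distrib_right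
    by (intro sum_norm_le) (simp add: norm_mult mult_left_mono norm_ell2_seq_le)
qed

text \<open>
  A convergent sequence is bounded, so the partial sums of the row are pointwise bounded; a
  uniform bound on them passes to their limit.
\<close>

lemma row_functional_bounded:
  fixes a :: "nat \<Rightarrow> 'a::{real_normed_field, banach}"
  assumes summable: "\<And>c. square_summable c \<Longrightarrow> summable (\<lambda>k. a k * c k)"
  shows "\<exists>K. \<forall>c. norm (\<Sum>k. a k * ell2_seq c k) \<le> K * norm c"
proof -
  let ?S = "\<lambda>m c. \<Sum>k<m. a k * ell2_seq c k"
  have lim: "(\<lambda>m. ?S m c) \<longlonglongrightarrow> (\<Sum>k. a k * ell2_seq c k)" for c
    by (intro summable_LIMSEQ summable square_summable_ell2_seq)
  have "\<exists>K. \<forall>m c. norm (?S m c) \<le> K * norm c"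
  proof (rule uniform_boundedness_seminorms)
    fix m r and c d :: "'a ell2"
    have "?S m (c + d) = ?S m c + ?S m d"
      by (simp add: plus_ell2.rep_eq distrib_left sum.distrib)
    then show "norm (?S m (c + d)) \<le> norm (?S m c) + norm (?S m d)"
      by (simp add: norm_triangle_ineq)
    have "?S m (r *\<^sub>R c) = r *\<^sub>R ?S m c"
      by (simp add: scaleR_ell2.rep_eq scaleR_sum_right)
    then show "norm (?S m (r *\<^sub>R c)) = \<bar>r\<bar> * norm (?S m c)"
      by simp
    show "\<exists>B. \<forall>m. norm (?S m c) \<le> B"
      using convergent_imp_Bseq[OF convergentI[OF lim[of c]]] by (auto simp: Bseq_def)
  qed (rule finite_row_bounded)
  then obtain K where K: "\<And>m c. norm (?S m c) \<le> K * norm c" by blast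
  have "norm (\<Sum>k. a k * ell2_seq c k) \<le> K * norm c" for c
    by (rule LIMSEQ_le_const2[OF tendsto_norm[OF lim]]) (use K in blast)
  then show ?thesis by blast
qed

lemma matrix_times_add:
  assumes "defines_matrix_mapping E" "square_summable c" "square_summable d"
  shows "matrix_times E (\<lambda>k. c k + d k) n = matrix_times E c n + matrix_times E d n"
  using assms
  by (simp add: matrix_times_def defines_matrix_mapping_def distrib_left suminf_add)

lemma matrix_times_mult:
  assumes "defines_matrix_mapping E" "square_summable c"
  shows "matrix_times E (\<lambda>k. s * c k) n = s * matrix_times E c n"
  using assms
  by (simp add: matrix_times_def defines_matrix_mapping_def mult.left_commute suminf_mult)

text \<open>
  Membership of \<open>E c\<close> in \<open>\<ell>\<^sup>2\<close> bounds the Euclidean norms of its truncations for each \<open>c\<close>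
  separately. Each truncation involves finitely many rows, so the bounds on the single row
  functionals make it bounded, as uniform boundedness requires.
\<close>

lemma matrix_truncations_uniformly_bounded:
  fixes E :: "nat \<Rightarrow> nat \<Rightarrow> 'a::{real_normed_field, banach}"
  assumes E: "defines_matrix_mapping E"
  shows "\<exists>K. \<forall>m c. L2_set (\<lambda>n. norm (matrix_times E (ell2_seq c) n)) {..<m} \<le> K * norm c"
proof (rule uniform_boundedness_seminorms)
  let ?E = "\<lambda>c. matrix_times E (ell2_seq c)"
  fix m r and c d :: "'a ell2"
  have "L2_set (\<lambda>n. norm (?E (c + d) n)) {..<m}
          \<le> L2_set (\<lambda>n. norm (?E c n) + norm (?E d n)) {..<m}"
    by (intro L2_set_mono)
      (simp_all add: plus_ell2.rep_eq matrix_times_add E square_summable_ell2_seq norm_triangle_ineq)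
  also have "\<dots> \<le> L2_set (\<lambda>n. norm (?E c n)) {..<m} + L2_set (\<lambda>n. norm (?E d n)) {..<m}"
    by (rule L2_set_triangle_ineq)
  finally show "L2_set (\<lambda>n. norm (?E (c + d) n)) {..<m}
      \<le> L2_set (\<lambda>n. norm (?E c n)) {..<m} + L2_set (\<lambda>n. norm (?E d n)) {..<m}" .
  show "L2_set (\<lambda>n. norm (?E (r *\<^sub>R c) n)) {..<m} = \<bar>r\<bar> * L2_set (\<lambda>n. norm (?E c n)) {..<m}"
    by (simp add: scaleR_ell2.rep_eq scaleR_conv_of_real[of r] matrix_times_mult E
        square_summable_ell2_seq norm_mult L2_set_right_distrib)
  show "\<exists>B. \<forall>m. L2_set (\<lambda>n. norm (?E c n)) {..<m} \<le> B"
    using E square_summable_ell2_seq[of c] L2_set_le_suminf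
    unfolding defines_matrix_mapping_def by blast
  have "\<forall>n. \<exists>K. \<forall>c. norm (?E c n) \<le> K * norm c"
    using E row_functional_bounded unfolding matrix_times_def defines_matrix_mapping_def by blast
  then obtain K where K: "\<And>n c. norm (?E c n) \<le> K n * norm c" by metis
  have "L2_set (\<lambda>n. norm (?E c n)) {..<m} \<le> (\<Sum>n<m. K n) * norm c" for c
  proof -
    have "L2_set (\<lambda>n. norm (?E c n)) {..<m} \<le> (\<Sum>n<m. norm (?E c n))"
      by (rule L2_set_le_sum) simp
    also have "\<dots> \<le> (\<Sum>n<m. K n) * norm c"
      unfolding sum_distrib_right by (intro sum_mono K)
    finally show ?thesis .
  qed
  then show "\<exists>K. \<forall>c. L2_set (\<lambda>n. norm (?E c n)) {..<m} \<le> K * norm c" by blast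
qed

theorem theorem2p5:
  fixes E :: "nat \<Rightarrow> nat \<Rightarrow> 'a::{real_normed_field, banach}"
  assumes "defines_matrix_mapping E"
  shows "\<exists>T :: 'a ell2 \<Rightarrow> 'a ell2.
           (\<forall>c. ell2_seq (T c) = matrix_times E (ell2_seq c)) \<and>
           Vector_Spaces.linear ell2_scale ell2_scale T \<and>
           bounded_linear T"
proof -
  define T where "T c = Abs_ell2 (matrix_times E (ell2_seq c))" for c :: "'a ell2"
  have T: "ell2_seq (T c) = matrix_times E (ell2_seq c)" for c
    using assms square_summable_ell2_seq[of c]
    by (simp add: T_def Abs_ell2_inverse defines_matrix_mapping_def)
  have add: "T (c + d) = T c + T d" for c d
    by (simp add: ell2_seq_inject[symmetric] fun_eq_iff T plus_ell2.rep_eq matrix_times_add assms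
        square_summable_ell2_seq)
  have scale: "T (ell2_scale s c) = ell2_scale s (T c)" for s c
    by (simp add: ell2_seq_inject[symmetric] fun_eq_iff T ell2_scale.rep_eq matrix_times_mult assms
        square_summable_ell2_seq)
  have real_scale: "r *\<^sub>R c = ell2_scale (of_real r) c" for r and c :: "'a ell2"
    by transfer (simp add: scaleR_conv_of_real)
  obtain K where
    K: "\<And>m c. L2_set (\<lambda>n. norm (matrix_times E (ell2_seq c) n)) {..<m} \<le> K * norm c"
    using matrix_truncations_uniformly_bounded[OF assms] by blast
  have "norm (T c) \<le> norm c * K" for c
    using K[of c] by (intro norm_ell2_le) (simp add: T mult.commute)
  then have "bounded_linear T"
    by (intro bounded_linear_intro[of T K] add) (simp_all add: real_scale scale)
  moreover have "Vector_Spaces.linear ell2_scale ell2_scale T"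
    by (simp add: Vector_Spaces.linear_iff vector_space_ell2_scale add scale)
  ultimately show ?thesis using T by blast
qed

end
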